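(* Let $f:\{0,1\}^n\to\{0,1\}$ be any Boolean function and let $0\le \varepsilon<1$. Then $$\big(\mathsf{OBDD}(f)\big)^{1-\varepsilon}\;\le\;\mathsf{LV\text{-}OBDD}_{\varepsilon}(f).$$
   Context: A deterministic OBDD of width $m$ over variables $x_1,\dots,x_n$ consists of a permutation $\pi$ of $\{1,\dots,n\}$ (the variable order), a set $S$ of $m$ states, an initial state, for each step $j\in\{1,\dots,n\}$ two maps $T_j^0,T_j^1:S\to S$, and a set of accepting states. On input $x\in\{0,1\}^n$ it starts in the initial state, at step $j$ applies $T_j^{x_{\pi(j)}}$, and outputs $1$ iff the final state is accepting. (Equivalently, an oblivious leveled read-once branching program of width $m$.) $\mathsf{OBDD}(f)$ is the minimum width of a deterministic OBDD (with any order) computing $f$. A probabilistic OBDD (POBDD) of width $m$ is defined similarly, except that the initial state is a probability distribution (stochastic column vector) on $S$ and $T_j^0,T_j^1$ are $m\times m$ column-stochastic matrices; the state after step $j$ is $v_j=T_j^{x_{\pi(j)}}v_{j-1}$. A Las Vegas POBDD has $S$ partitioned into accepting, rejecting and neutral ("don't know") states; it computes $f$ with error bound $\varepsilon$ if for every input $x$ the final distribution puts probability $0$ on states giving the wrong answer (rejecting states if $f(x)=1$, accepting states if $f(x)=0$) and probability at least $1-\varepsilon$ on states giving the correct answer. $\mathsf{LV\text{-}OBDD}_{\varepsilon}(f)$ is the minimum width of a Las Vegas POBDD (any order) computing $f$ with error bound $\varepsilon$. *)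

theory Defs
  imports
    "HOL-Analysis.Analysis"
    "HOL-Combinatorics.Permutations"
    "Jordan_Normal_Form.Matrix"
begin

text \<open>
  Inputs are functions on \<open>{1..n}\<close> (extensional outside), and the bits 0 and 1 are
  \<^const>\<open>False\<close> and \<^const>\<open>True\<close>. A Boolean function on \<open>n\<close> variables is a function on
  \<open>nat \<Rightarrow> bool\<close> of which only the values on \<open>bool_cube n\<close> are used.
\<close>

definition bool_cube :: "nat \<Rightarrow> (nat \<Rightarrow> bool) set" where
  "bool_cube n = {1..n} \<rightarrow>\<^sub>E UNIV"

subsection \<open>Deterministic OBDDs\<close>

text \<open>The \<open>m\<close> states of a program of width \<open>m\<close> are the numbers in \<open>{..<m}\<close>.\<close>

record obdd =
  obdd_order :: "nat \<Rightarrow> nat"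
  obdd_init :: nat
  obdd_trans :: "nat \<Rightarrow> bool \<Rightarrow> nat \<Rightarrow> nat"
  obdd_acc :: "nat set"

definition is_obdd :: "nat \<Rightarrow> nat \<Rightarrow> obdd \<Rightarrow> bool" where
  "is_obdd n m B \<longleftrightarrow>
     obdd_order B permutes {1..n} \<and>
     obdd_init B \<in> {..<m} \<and>
     (\<forall>j\<in>{1..n}. \<forall>b. obdd_trans B j b \<in> {..<m} \<rightarrow> {..<m}) \<and>
     obdd_acc B \<subseteq> {..<m}"

primrec obdd_state :: "obdd \<Rightarrow> (nat \<Rightarrow> bool) \<Rightarrow> nat \<Rightarrow> nat" where
  "obdd_state B x 0 = obdd_init B"
| "obdd_state B x (Suc j) =
     obdd_trans B (Suc j) (x (obdd_order B (Suc j))) (obdd_state B x j)"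

definition obdd_computes :: "nat \<Rightarrow> obdd \<Rightarrow> ((nat \<Rightarrow> bool) \<Rightarrow> bool) \<Rightarrow> bool" where
  "obdd_computes n B f \<longleftrightarrow> (\<forall>x\<in>bool_cube n. f x \<longleftrightarrow> obdd_state B x n \<in> obdd_acc B)"

definition OBDD :: "nat \<Rightarrow> ((nat \<Rightarrow> bool) \<Rightarrow> bool) \<Rightarrow> nat" where
  "OBDD n f = (LEAST m. \<exists>B. is_obdd n m B \<and> obdd_computes n B f)"

subsection \<open>Las Vegas probabilistic OBDDs\<close>

definition stochastic_vec :: "nat \<Rightarrow> real vec \<Rightarrow> bool" where
  "stochastic_vec m v \<longleftrightarrow>
     v \<in> carrier_vec m \<and> (\<forall>i<m. 0 \<le> vec_index v i) \<and> (\<Sum>i<m. vec_index v i) = 1"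

definition column_stochastic_mat :: "nat \<Rightarrow> real mat \<Rightarrow> bool" where
  "column_stochastic_mat m A \<longleftrightarrow>
     A \<in> carrier_mat m m \<and> (\<forall>k<m. stochastic_vec m (col A k))"

record pobdd =
  pobdd_order :: "nat \<Rightarrow> nat"
  pobdd_init :: "real vec"
  pobdd_trans :: "nat \<Rightarrow> bool \<Rightarrow> real mat"

record lv_pobdd = pobdd +
  lv_acc :: "nat set"
  lv_rej :: "nat set"
  lv_neutral :: "nat set"

definition is_pobdd :: "nat \<Rightarrow> nat \<Rightarrow> 'a pobdd_scheme \<Rightarrow> bool" where
  "is_pobdd n m P \<longleftrightarrow>
     pobdd_order P permutes {1..n} \<and>
     stochastic_vec m (pobdd_init P) \<and>
     (\<forall>j\<in>{1..n}. \<forall>b. column_stochastic_mat m (pobdd_trans P j b))"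

text \<open>The three classes of states are pairwise disjoint and cover the state set, but any of
  them may be empty.\<close>

definition is_lv_pobdd :: "nat \<Rightarrow> nat \<Rightarrow> lv_pobdd \<Rightarrow> bool" where
  "is_lv_pobdd n m P \<longleftrightarrow>
     is_pobdd n m P \<and>
     lv_acc P \<union> lv_rej P \<union> lv_neutral P = {..<m} \<and>
     lv_acc P \<inter> lv_rej P = {} \<and>
     lv_acc P \<inter> lv_neutral P = {} \<and>
     lv_rej P \<inter> lv_neutral P = {}"

primrec pobdd_dist :: "'a pobdd_scheme \<Rightarrow> (nat \<Rightarrow> bool) \<Rightarrow> nat \<Rightarrow> real vec" where
  "pobdd_dist P x 0 = pobdd_init P"
| "pobdd_dist P x (Suc j) =
     pobdd_trans P (Suc j) (x (pobdd_order P (Suc j))) *\<^sub>v pobdd_dist P x j"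

definition pobdd_prob :: "nat \<Rightarrow> 'a pobdd_scheme \<Rightarrow> (nat \<Rightarrow> bool) \<Rightarrow> nat set \<Rightarrow> real" where
  "pobdd_prob n P x A = (\<Sum>i\<in>A. vec_index (pobdd_dist P x n) i)"

definition lv_computes ::
    "nat \<Rightarrow> real \<Rightarrow> lv_pobdd \<Rightarrow> ((nat \<Rightarrow> bool) \<Rightarrow> bool) \<Rightarrow> bool" where
  "lv_computes n \<epsilon> P f \<longleftrightarrow>
     (\<forall>x\<in>bool_cube n.
        (f x \<longrightarrow> pobdd_prob n P x (lv_rej P) = 0 \<and> pobdd_prob n P x (lv_acc P) \<ge> 1 - \<epsilon>) \<and>
        (\<not> f x \<longrightarrow> pobdd_prob n P x (lv_acc P) = 0 \<and> pobdd_prob n P x (lv_rej P) \<ge> 1 - \<epsilon>))"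

definition LV_OBDD :: "nat \<Rightarrow> real \<Rightarrow> ((nat \<Rightarrow> bool) \<Rightarrow> bool) \<Rightarrow> nat" where
  "LV_OBDD n \<epsilon> f = (LEAST m. \<exists>P. is_lv_pobdd n m P \<and> lv_computes n \<epsilon> P f)"

end

theory Submission
  imports Defs
begin

text \<open>
  Cut a Las Vegas program of width \<open>m\<close> at a level and choose one input for each of the \<open>N\<close>
  subfunctions of \<open>f\<close> at that level. As the largest such \<open>N\<close> is the deterministic width for the same
  variable order, \<open>N powr (1 - \<epsilon>) \<le> m\<close> suffices. Let \<open>a\<close> be a uniformly chosen representative and
  \<open>s\<close> the random state it leads to; then \<open>ln N = H(a) \<le> H(a | s) + ln m\<close>, and the claim is that
  \<open>H(a | s) \<le> \<epsilon> * H(a)\<close>. Two distinct representatives are told apart by a suffix, whose answer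
  \<open>g a\<close> is determined by \<open>s\<close> unless \<open>s\<close> is a state from which the program never answers; every
  representative leads to such states with probability at most \<open>\<epsilon>\<close>. Gibbs' inequality turns this
  into \<open>H(g a | s) \<le> \<epsilon> * H(g a)\<close>, and the chain rule, applied to both sides, reduces the claim to
  the fibres of \<open>g\<close>.
\<close>

section \<open>Deterministic width and subfunctions\<close>

text \<open>
  A program whose states after \<open>j\<close> steps form an arbitrary set \<open>Q j\<close>, injected into the numbers by
  \<open>e j\<close>. Numbers that encode no state are left unchanged by a step.
\<close>

definition level_obdd ::
    "nat \<Rightarrow> (nat \<Rightarrow> nat) \<Rightarrow> (nat \<Rightarrow> 'q set) \<Rightarrow> 'q \<Rightarrow> (nat \<Rightarrow> bool \<Rightarrow> 'q \<Rightarrow> 'q) \<Rightarrow> 'q set \<Rightarrow>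
      (nat \<Rightarrow> 'q \<Rightarrow> nat) \<Rightarrow> obdd" where
  "level_obdd n \<pi> Q q0 \<delta> F e = \<lparr> obdd_order = \<pi>, obdd_init = e 0 q0,
    obdd_trans = (\<lambda>j b k. if k \<in> e (j - 1) ` Q (j - 1)
      then e j (\<delta> (j - 1) b (inv_into (Q (j - 1)) (e (j - 1)) k)) else k),
    obdd_acc = e n ` (F \<inter> Q n) \<rparr>"

lemma is_obdd_level_obdd:
  assumes "\<pi> permutes {1..n}" "q0 \<in> Q 0"
    and step: "\<And>j b q. j < n \<Longrightarrow> q \<in> Q j \<Longrightarrow> \<delta> j b q \<in> Q (Suc j)"
    and e_less: "\<And>j q. j \<le> n \<Longrightarrow> q \<in> Q j \<Longrightarrow> e j q < m"
  shows "is_obdd n m (level_obdd n \<pi> Q q0 \<delta> F e)"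
proof -
  have "obdd_trans (level_obdd n \<pi> Q q0 \<delta> F e) j b k < m" if "j \<in> {1..n}" "k < m" for j b k
    using that e_less[of j] step[of "j - 1"] by (auto simp: level_obdd_def inv_into_into)
  then show ?thesis
    using assms by (auto simp: is_obdd_def level_obdd_def)
qed

lemma obdd_state_level_obdd:
  assumes "q0 \<in> Q 0" and step: "\<And>j b q. j < n \<Longrightarrow> q \<in> Q j \<Longrightarrow> \<delta> j b q \<in> Q (Suc j)"
    and e_inj: "\<And>j. j \<le> n \<Longrightarrow> inj_on (e j) (Q j)"
    and state_0: "\<sigma> 0 = q0"
    and state_Suc: "\<And>j. j < n \<Longrightarrow> \<sigma> (Suc j) = \<delta> j (x (\<pi> (Suc j))) (\<sigma> j)"
    and "j \<le> n"
  shows "\<sigma> j \<in> Q j \<and> obdd_state (level_obdd n \<pi> Q q0 \<delta> F e) x j = e j (\<sigma> j)"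
  using \<open>j \<le> n\<close>
proof (induction j)
  case 0
  then show ?case
    using assms(1) by (simp add: level_obdd_def state_0)
next
  case (Suc j)
  then show ?case
    using step e_inj[of j] by (simp add: level_obdd_def state_Suc)
qed

lemma obdd_of_level_sets:
  fixes Q :: "nat \<Rightarrow> 'q set"
  assumes \<pi>: "\<pi> permutes {1..n}"
    and Q: "\<And>j. j \<le> n \<Longrightarrow> finite (Q j) \<and> card (Q j) \<le> m"
    and start: "q0 \<in> Q 0"
    and step: "\<And>j b q. j < n \<Longrightarrow> q \<in> Q j \<Longrightarrow> \<delta> j b q \<in> Q (Suc j)"
    and state_0: "\<And>x. x \<in> bool_cube n \<Longrightarrow> \<sigma> x 0 = q0"
    and state_Suc: "\<And>x j. x \<in> bool_cube n \<Longrightarrow> j < n \<Longrightarrow>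
      \<sigma> x (Suc j) = \<delta> j (x (\<pi> (Suc j))) (\<sigma> x j)"
    and accept: "\<And>x. x \<in> bool_cube n \<Longrightarrow> f x \<longleftrightarrow> \<sigma> x n \<in> F"
  shows "\<exists>B. is_obdd n m B \<and> obdd_computes n B f"
proof -
  have "\<exists>e. e ` Q j \<subseteq> {..<m} \<and> inj_on e (Q j)" if "j \<le> n" for j
    using Q[OF that] by (intro card_le_inj) auto
  then obtain e where e_less: "\<And>j q. j \<le> n \<Longrightarrow> q \<in> Q j \<Longrightarrow> e j q < m"
    and e_inj: "\<And>j. j \<le> n \<Longrightarrow> inj_on (e j) (Q j)"
    by (metis image_subset_iff lessThan_iff)
  let ?B = "level_obdd n \<pi> Q q0 \<delta> F e"
  have "obdd_computes n ?B f"
    unfolding obdd_computes_def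
  proof
    fix x assume x: "x \<in> bool_cube n"
    have "\<sigma> x n \<in> Q n \<and> obdd_state ?B x n = e n (\<sigma> x n)"
      by (rule obdd_state_level_obdd) (use x start step state_0 state_Suc e_inj in auto)
    then have "obdd_state ?B x n \<in> obdd_acc ?B \<longleftrightarrow> \<sigma> x n \<in> F"
      using inj_on_image_mem_iff[OF e_inj, of n "\<sigma> x n" "F \<inter> Q n"] by (simp add: level_obdd_def)
    then show "f x \<longleftrightarrow> obdd_state ?B x n \<in> obdd_acc ?B"
      using accept[OF x] by simp
  qed
  moreover have "is_obdd n m ?B"
    using \<pi> start step e_less by (rule is_obdd_level_obdd)
  ultimately show ?thesis by blast
qed

text \<open>
  A subfunction is represented by its true set; after the values of \<open>x\<close> have been substituted, it
  no longer depends on the variables \<open>\<pi> 1, \<dots>, \<pi> j\<close>.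
\<close>

definition subfunction ::
    "nat \<Rightarrow> ((nat \<Rightarrow> bool) \<Rightarrow> bool) \<Rightarrow> (nat \<Rightarrow> nat) \<Rightarrow> nat \<Rightarrow> (nat \<Rightarrow> bool) \<Rightarrow> (nat \<Rightarrow> bool) set" where
  "subfunction n f \<pi> j x = {y \<in> bool_cube n. f (override_on y x (\<pi> ` {1..j}))}"

definition subfunctions ::
    "nat \<Rightarrow> ((nat \<Rightarrow> bool) \<Rightarrow> bool) \<Rightarrow> (nat \<Rightarrow> nat) \<Rightarrow> nat \<Rightarrow> (nat \<Rightarrow> bool) set set" where
  "subfunctions n f \<pi> j = subfunction n f \<pi> j ` bool_cube n"

lemma finite_bool_cube: "finite (bool_cube n)"
  by (simp add: bool_cube_def finite_PiE)

lemma bool_cube_not_empty: "bool_cube n \<noteq> {}"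
  by (simp add: bool_cube_def PiE_eq_empty_iff)

lemma bool_cube_outside: "x \<in> bool_cube n \<Longrightarrow> i \<notin> {1..n} \<Longrightarrow> x i = undefined"
  unfolding bool_cube_def by (rule PiE_arb)

lemma override_on_in_bool_cube:
  "x \<in> bool_cube n \<Longrightarrow> y \<in> bool_cube n \<Longrightarrow> override_on y x A \<in> bool_cube n"
  by (simp add: bool_cube_def PiE_def extensional_def override_on_def)

lemma fun_upd_in_bool_cube: "x \<in> bool_cube n \<Longrightarrow> i \<in> {1..n} \<Longrightarrow> x(i := b) \<in> bool_cube n"
  by (auto simp: bool_cube_def PiE_def extensional_def)

lemma subfunction_Suc:
  assumes "\<pi> (Suc j) \<in> {1..n}"
  shows "subfunction n f \<pi> (Suc j) x =
    {y \<in> bool_cube n. y(\<pi> (Suc j) := x (\<pi> (Suc j))) \<in> subfunction n f \<pi> j x}"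
  using fun_upd_in_bool_cube[OF _ assms]
  by (auto simp: subfunction_def atLeastAtMostSuc_conv override_on_insert')

lemma subfunction_full:
  assumes "\<pi> permutes {1..n}" "x \<in> bool_cube n"
  shows "subfunction n f \<pi> n x = {y \<in> bool_cube n. f x}"
proof -
  have "override_on y x {1..n} = x" if y: "y \<in> bool_cube n" for y
  proof
    fix i
    show "override_on y x {1..n} i = x i"
      using bool_cube_outside[OF y, of i] bool_cube_outside[OF assms(2), of i]
      unfolding override_on_def by presburger
  qed
  then show ?thesis
    unfolding subfunction_def permutes_image[OF assms(1)] by auto
qed

lemma subfunction_fun_upd:
  assumes "inj \<pi>"
  shows "subfunction n f \<pi> j (x(\<pi> (Suc j) := b)) = subfunction n f \<pi> j x"
proof -
  have "\<pi> (Suc j) \<notin> \<pi> ` {1..j}"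
    by (simp add: inj_image_mem_iff[OF assms])
  then have "override_on y (x(\<pi> (Suc j) := b)) (\<pi> ` {1..j}) = override_on y x (\<pi> ` {1..j})" for y
    by (auto simp: override_on_def fun_eq_iff)
  then show ?thesis
    by (simp add: subfunction_def)
qed

lemma obdd_of_card_subfunctions_le:
  assumes \<pi>: "\<pi> permutes {1..n}" and card: "\<And>j. j \<le> n \<Longrightarrow> card (subfunctions n f \<pi> j) \<le> m"
  shows "\<exists>B. is_obdd n m B \<and> obdd_computes n B f"
proof (rule obdd_of_level_sets[OF \<pi>])
  have next_var: "\<pi> (Suc j) \<in> {1..n}" if "j < n" for j
    using that permutes_in_image[OF \<pi>, of "Suc j"] by simp
  let ?\<delta> = "\<lambda>j b q. {y \<in> bool_cube n. y(\<pi> (Suc j) := b) \<in> q}"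
  show "finite (subfunctions n f \<pi> j) \<and> card (subfunctions n f \<pi> j) \<le> m" if "j \<le> n" for j
    using card[OF that] by (simp add: subfunctions_def finite_bool_cube)
  show "{y \<in> bool_cube n. f y} \<in> subfunctions n f \<pi> 0"
    using bool_cube_not_empty by (auto simp: subfunctions_def subfunction_def)
  show "?\<delta> j b q \<in> subfunctions n f \<pi> (Suc j)" if "j < n" "q \<in> subfunctions n f \<pi> j" for j b q
  proof -
    obtain x where x: "x \<in> bool_cube n" "q = subfunction n f \<pi> j x"
      using \<open>q \<in> subfunctions n f \<pi> j\<close> by (auto simp: subfunctions_def)
    have "?\<delta> j b q = subfunction n f \<pi> (Suc j) (x(\<pi> (Suc j) := b))"
      by (subst subfunction_Suc[where \<pi> = \<pi>, OF next_var[OF \<open>j < n\<close>]])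
        (simp add: x(2) subfunction_fun_upd[OF permutes_inj[OF \<pi>]])
    moreover have "x(\<pi> (Suc j) := b) \<in> bool_cube n"
      using x(1) next_var[OF \<open>j < n\<close>] by (rule fun_upd_in_bool_cube)
    ultimately show ?thesis
      by (simp add: subfunctions_def)
  qed
  show "subfunction n f \<pi> 0 x = {y \<in> bool_cube n. f y}" for x
    by (simp add: subfunction_def)
  show "subfunction n f \<pi> (Suc j) x = ?\<delta> j (x (\<pi> (Suc j))) (subfunction n f \<pi> j x)"
    if "j < n" for x j
    by (rule subfunction_Suc[where \<pi> = \<pi>, OF next_var[OF that]])
  show "f x \<longleftrightarrow> subfunction n f \<pi> n x \<in> - {{}}" if "x \<in> bool_cube n" for x
    using that by (auto simp: subfunction_full[OF \<pi>])
qed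

lemma obdd_of_some_card_subfunctions:
  assumes \<pi>: "\<pi> permutes {1..n}"
  obtains j B where "j \<le> n" "is_obdd n (card (subfunctions n f \<pi> j)) B" "obdd_computes n B f"
proof -
  let ?N = "\<lambda>j. card (subfunctions n f \<pi> j)"
  have "Max (?N ` {..n}) \<in> ?N ` {..n}"
    by (rule Max_in) auto
  then obtain j where j: "j \<le> n" "Max (?N ` {..n}) = ?N j"
    by blast
  then have "?N i \<le> ?N j" if "i \<le> n" for i
    using Max_ge[of "?N ` {..n}" "?N i"] that by simp
  then show thesis
    using obdd_of_card_subfunctions_le[OF \<pi>] j(1) that by blast
qed

lemma OBDD_le_card_subfunctions:
  assumes "\<pi> permutes {1..n}"
  obtains j where "j \<le> n" "OBDD n f \<le> card (subfunctions n f \<pi> j)"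
  using obdd_of_some_card_subfunctions[OF assms, of f] that unfolding OBDD_def
  by (metis (mono_tags, lifting) Least_le)

section \<open>Distributions of probabilistic programs\<close>

lemma
  assumes "column_stochastic_mat m A" "k < m"
  shows column_stochastic_mat_nonneg: "\<And>i. i < m \<Longrightarrow> 0 \<le> A $$ (i, k)"
    and column_stochastic_mat_sum: "(\<Sum>i<m. A $$ (i, k)) = 1"
  using assms by (auto simp: column_stochastic_mat_def stochastic_vec_def)

lemma column_stochastic_mat_average:
  assumes "column_stochastic_mat m A" "k < m" and h: "\<And>i. i < m \<Longrightarrow> 0 \<le> h i \<and> h i \<le> 1"
  shows "0 \<le> (\<Sum>i<m. A $$ (i, k) * h i) \<and> (\<Sum>i<m. A $$ (i, k) * h i) \<le> 1"
proof
  have nonneg: "0 \<le> A $$ (i, k)" if "i < m" for i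
    using assms that by (intro column_stochastic_mat_nonneg)
  show "0 \<le> (\<Sum>i<m. A $$ (i, k) * h i)"
    using nonneg h by (intro sum_nonneg mult_nonneg_nonneg) auto
  have "(\<Sum>i<m. A $$ (i, k) * h i) \<le> (\<Sum>i<m. A $$ (i, k))"
    using nonneg h by (intro sum_mono mult_left_le) auto
  then show "(\<Sum>i<m. A $$ (i, k) * h i) \<le> 1"
    using column_stochastic_mat_sum[OF assms(1,2)] by simp
qed

lemma index_mult_mat_vec_sum:
  assumes "A \<in> carrier_mat l m" "v \<in> carrier_vec m" "i < l"
  shows "vec_index (A *\<^sub>v v) i = (\<Sum>k<m. A $$ (i, k) * vec_index v k)"
  using assms by (auto simp: scalar_prod_def lessThan_atLeast0)

lemma sum_mult_mat_vec:
  fixes A :: "'a::comm_semiring_0 mat"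
  assumes "A \<in> carrier_mat l m" "v \<in> carrier_vec m"
  shows "(\<Sum>i<l. vec_index (A *\<^sub>v v) i * h i) = (\<Sum>k<m. vec_index v k * (\<Sum>i<l. A $$ (i, k) * h i))"
proof -
  have "(\<Sum>i<l. vec_index (A *\<^sub>v v) i * h i) = (\<Sum>i<l. \<Sum>k<m. vec_index v k * (A $$ (i, k) * h i))"
    by (simp add: index_mult_mat_vec_sum[OF assms] sum_distrib_left mult_ac)
  also have "\<dots> = (\<Sum>k<m. vec_index v k * (\<Sum>i<l. A $$ (i, k) * h i))"
    by (subst sum.swap) (simp add: sum_distrib_left)
  finally show ?thesis .
qed

lemma stochastic_vec_mult_mat_vec:
  assumes A: "column_stochastic_mat m A" and v: "stochastic_vec m v"
  shows "stochastic_vec m (A *\<^sub>v v)"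
proof -
  have carrier: "A \<in> carrier_mat m m" "v \<in> carrier_vec m"
    using A v by (simp_all add: column_stochastic_mat_def stochastic_vec_def)
  have "0 \<le> vec_index (A *\<^sub>v v) i" if "i < m" for i
    using v that column_stochastic_mat_nonneg[OF A]
    by (auto simp: index_mult_mat_vec_sum[OF carrier] stochastic_vec_def intro!: sum_nonneg)
  moreover have "(\<Sum>i<m. vec_index (A *\<^sub>v v) i) = 1"
    using v sum_mult_mat_vec[OF carrier, of "\<lambda>_. 1"]
    by (simp add: column_stochastic_mat_sum[OF A] stochastic_vec_def)
  ultimately show ?thesis
    using carrier by (simp add: stochastic_vec_def)
qed

lemma stochastic_vec_pobdd_dist:
  assumes "is_pobdd n m P" "j \<le> n"
  shows "stochastic_vec m (pobdd_dist P x j)"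
  using assms(2)
proof (induction j)
  case 0
  then show ?case
    using assms(1) by (simp add: is_pobdd_def)
next
  case (Suc j)
  then show ?case
    using assms(1) by (auto simp: is_pobdd_def intro!: stochastic_vec_mult_mat_vec)
qed

lemma pobdd_dist_cong:
  assumes "\<And>i. i \<in> {1..j} \<Longrightarrow> x (pobdd_order P i) = y (pobdd_order P i)"
  shows "pobdd_dist P x j = pobdd_dist P y j"
  using assms by (induction j) auto

definition state_prob :: "'a pobdd_scheme \<Rightarrow> nat \<Rightarrow> (nat \<Rightarrow> bool) \<Rightarrow> nat \<Rightarrow> real" where
  "state_prob P j x s = vec_index (pobdd_dist P x j) s"

lemma
  assumes "is_pobdd n m P" "j \<le> n"
  shows state_prob_nonneg: "\<And>s. s < m \<Longrightarrow> 0 \<le> state_prob P j x s"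
    and sum_state_prob: "(\<Sum>s<m. state_prob P j x s) = 1"
  using stochastic_vec_pobdd_dist[OF assms, of x]
  by (simp_all add: state_prob_def stochastic_vec_def)

text \<open>
  \<open>h s\<close> is the probability to end in \<open>A\<close> when the program is run on \<open>y\<close> from state \<open>s\<close> at level \<open>j\<close>.
\<close>

lemma pobdd_prob_override_on:
  assumes P: "is_pobdd n m P" and A: "A \<subseteq> {..<m}" and "j \<le> n"
  shows "\<exists>h. (\<forall>s<m. 0 \<le> h s \<and> h s \<le> 1) \<and>
    (\<forall>x. pobdd_prob n P (override_on y x (pobdd_order P ` {1..j})) A =
      (\<Sum>s<m. state_prob P j x s * h s))"
  using \<open>j \<le> n\<close>
proof (induction j rule: inc_induct)
  case base
  have "pobdd_dist P (override_on y x (pobdd_order P ` {1..n})) n = pobdd_dist P x n" for x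
    by (rule pobdd_dist_cong) simp
  then have "pobdd_prob n P (override_on y x (pobdd_order P ` {1..n})) A =
      (\<Sum>s<m. state_prob P n x s * of_bool (s \<in> A))" for x
    unfolding pobdd_prob_def state_prob_def using A by (intro sum.mono_neutral_cong_left) auto
  then show ?case
    by (intro exI[of _ "\<lambda>s. of_bool (s \<in> A)"]) simp
next
  case (step j)
  let ?i = "pobdd_order P (Suc j)"
  define T where "T = pobdd_trans P (Suc j) (y ?i)"
  from step.IH obtain h where h: "\<forall>s<m. 0 \<le> h s \<and> h s \<le> 1"
    and prob: "\<forall>x. pobdd_prob n P (override_on y x (pobdd_order P ` {1..Suc j})) A =
      (\<Sum>s<m. state_prob P (Suc j) x s * h s)"
    by (elim exE conjE)
  define h' where "h' s = (\<Sum>i<m. T $$ (i, s) * h i)" for s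
  have inj: "inj (pobdd_order P)" and T: "column_stochastic_mat m T"
    using P step.hyps permutes_inj by (auto simp: is_pobdd_def T_def)
  have "0 \<le> h' s \<and> h' s \<le> 1" if "s < m" for s
    unfolding h'_def using T that h by (intro column_stochastic_mat_average) auto
  moreover have "pobdd_prob n P (override_on y x (pobdd_order P ` {1..j})) A =
      (\<Sum>s<m. state_prob P j x s * h' s)" for x
  proof -
    have fresh: "?i \<notin> pobdd_order P ` {1..j}"
      by (simp add: inj_image_mem_iff[OF inj])
    then have split: "override_on y x (pobdd_order P ` {1..j}) =
        override_on y (x(?i := y ?i)) (pobdd_order P ` {1..Suc j})"
      by (auto simp: override_on_def fun_eq_iff atLeastAtMostSuc_conv)
    have prefix: "pobdd_dist P (x(?i := y ?i)) j = pobdd_dist P x j"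
    proof (rule pobdd_dist_cong)
      show "(x(?i := y ?i)) (pobdd_order P i) = x (pobdd_order P i)" if "i \<in> {1..j}" for i
        using imageI[OF that, of "pobdd_order P"] fresh by (metis fun_upd_other)
    qed
    have "pobdd_prob n P (override_on y x (pobdd_order P ` {1..j})) A =
        (\<Sum>i<m. vec_index (T *\<^sub>v pobdd_dist P x j) i * h i)"
      unfolding split prob[rule_format] by (simp add: state_prob_def T_def prefix)
    also have "\<dots> = (\<Sum>s<m. state_prob P j x s * h' s)"
      unfolding h'_def state_prob_def using T stochastic_vec_pobdd_dist[OF P, of j x] step.hyps
      by (intro sum_mult_mat_vec) (auto simp: column_stochastic_mat_def stochastic_vec_def)
    finally show ?thesis .
  qed
  ultimately show ?case
    by (intro exI[of _ h']) simp
qed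

section \<open>Las Vegas programs\<close>

definition lv_answer :: "lv_pobdd \<Rightarrow> bool \<Rightarrow> nat set" where
  "lv_answer P b = (if b then lv_acc P else lv_rej P)"

lemma lv_answer_subset: "is_lv_pobdd n m P \<Longrightarrow> lv_answer P b \<subseteq> {..<m}"
  by (auto simp: is_lv_pobdd_def lv_answer_def)

lemma lv_computes_prob:
  assumes "lv_computes n \<epsilon> P f" "x \<in> bool_cube n"
  shows "1 - \<epsilon> \<le> pobdd_prob n P x (lv_answer P (f x))"
    and "pobdd_prob n P x (lv_answer P (\<not> f x)) = 0"
  using assms by (auto simp: lv_computes_def lv_answer_def)

definition function_mat :: "nat \<Rightarrow> (nat \<Rightarrow> nat) \<Rightarrow> real mat" where
  "function_mat m t = mat m m (\<lambda>(i, k). of_bool (i = t k))"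

lemma stochastic_unit_vec: "i < m \<Longrightarrow> stochastic_vec m (unit_vec m i)"
  by (simp add: stochastic_vec_def unit_vec_def)

lemma column_stochastic_function_mat:
  assumes "t \<in> {..<m} \<rightarrow> {..<m}"
  shows "column_stochastic_mat m (function_mat m t)"
proof -
  have "col (function_mat m t) k = unit_vec m (t k)" if "k < m" for k
    using that by (auto simp: function_mat_def unit_vec_def)
  moreover have "function_mat m t \<in> carrier_mat m m"
    by (simp add: function_mat_def)
  ultimately show ?thesis
    using assms by (auto simp: column_stochastic_mat_def intro: stochastic_unit_vec)
qed

lemma function_mat_mult_unit_vec:
  "k < m \<Longrightarrow> function_mat m t *\<^sub>v unit_vec m k = unit_vec m (t k)"
  by (intro eq_vecI) (auto simp: function_mat_def unit_vec_def[of m "t k"])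

definition lv_pobdd_of_obdd :: "nat \<Rightarrow> obdd \<Rightarrow> lv_pobdd" where
  "lv_pobdd_of_obdd m B = \<lparr> pobdd_order = obdd_order B, pobdd_init = unit_vec m (obdd_init B),
    pobdd_trans = (\<lambda>j b. function_mat m (obdd_trans B j b)),
    lv_acc = obdd_acc B, lv_rej = {..<m} - obdd_acc B, lv_neutral = {} \<rparr>"

lemma is_lv_pobdd_of_obdd: "is_obdd n m B \<Longrightarrow> is_lv_pobdd n m (lv_pobdd_of_obdd m B)"
  by (auto simp: is_obdd_def is_lv_pobdd_def is_pobdd_def lv_pobdd_of_obdd_def
      intro: stochastic_unit_vec column_stochastic_function_mat)

lemma obdd_state_less: "is_obdd n m B \<Longrightarrow> j \<le> n \<Longrightarrow> obdd_state B x j < m"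
  by (induction j) (auto simp: is_obdd_def Pi_iff)

lemma pobdd_dist_lv_pobdd_of_obdd:
  assumes "is_obdd n m B" "j \<le> n"
  shows "pobdd_dist (lv_pobdd_of_obdd m B) x j = unit_vec m (obdd_state B x j)"
  using assms(2)
proof (induction j)
  case (Suc j)
  then show ?case
    using obdd_state_less[OF assms(1), of j x]
    by (simp add: lv_pobdd_of_obdd_def function_mat_mult_unit_vec)
qed (simp add: lv_pobdd_of_obdd_def)

lemma pobdd_prob_lv_pobdd_of_obdd:
  assumes B: "is_obdd n m B" and A: "A \<subseteq> {..<m}"
  shows "pobdd_prob n (lv_pobdd_of_obdd m B) x A = of_bool (obdd_state B x n \<in> A)"
proof -
  have "pobdd_prob n (lv_pobdd_of_obdd m B) x A = (\<Sum>i\<in>A. of_bool (i = obdd_state B x n))"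
    unfolding pobdd_prob_def using A
    by (intro sum.cong) (auto simp: pobdd_dist_lv_pobdd_of_obdd[OF B] unit_vec_def)
  then show ?thesis
    using finite_subset[OF A] by (simp add: of_bool_def)
qed

lemma lv_computes_lv_pobdd_of_obdd:
  assumes B: "is_obdd n m B" and comp: "obdd_computes n B f" and "0 \<le> \<epsilon>"
  shows "lv_computes n \<epsilon> (lv_pobdd_of_obdd m B) f"
proof -
  have answers: "lv_acc (lv_pobdd_of_obdd m B) = obdd_acc B"
    "lv_rej (lv_pobdd_of_obdd m B) = {..<m} - obdd_acc B" "obdd_acc B \<subseteq> {..<m}"
    using B by (simp_all add: lv_pobdd_of_obdd_def is_obdd_def)
  show ?thesis
    using comp \<open>0 \<le> \<epsilon>\<close> obdd_state_less[OF B order_refl]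
    by (auto simp: lv_computes_def obdd_computes_def answers pobdd_prob_lv_pobdd_of_obdd[OF B])
qed

lemma LV_OBDD_attained:
  assumes "0 \<le> \<epsilon>"
  obtains P where "is_lv_pobdd n (LV_OBDD n \<epsilon> f) P" "lv_computes n \<epsilon> P f"
proof -
  obtain m B where "is_obdd n m B" "obdd_computes n B f"
    using obdd_of_some_card_subfunctions[OF permutes_id] by metis
  then have "\<exists>m P. is_lv_pobdd n m P \<and> lv_computes n \<epsilon> P f"
    using assms is_lv_pobdd_of_obdd lv_computes_lv_pobdd_of_obdd by blast
  from LeastI_ex[OF this] show thesis
    using that by (auto simp: LV_OBDD_def)
qed

section \<open>Entropy of finite weight functions\<close>

text \<open>
  Weights are not normalised, so that the entropies of the parts of a partition simply add up; the
  entropy of a probability distribution is scaled by the total mass. Terms with \<open>w a = 0\<close> vanish.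
\<close>

definition entropy :: "('a \<Rightarrow> real) \<Rightarrow> 'a set \<Rightarrow> real" where
  "entropy w A = (\<Sum>a\<in>A. w a * ln (sum w A / w a))"

lemma entropy_concentrated:
  assumes "finite A" and unique: "\<And>a b. a \<in> A \<Longrightarrow> b \<in> A \<Longrightarrow> w a \<noteq> 0 \<Longrightarrow> w b \<noteq> 0 \<Longrightarrow> a = b"
  shows "entropy w A = 0"
  unfolding entropy_def
proof (rule sum.neutral, rule ballI)
  fix a assume a: "a \<in> A"
  show "w a * ln (sum w A / w a) = 0"
  proof (cases "w a = 0")
    case False
    then have "sum w (A - {a}) = 0"
      using a unique by (intro sum.neutral) auto
    then have "sum w A = w a"
      using \<open>finite A\<close> a by (simp add: sum.remove)
    then show ?thesis
      using False by simp
  qed simp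
qed

lemma mult_ln_divide_le_diff:
  fixes x y :: real
  assumes "0 \<le> x" "0 < y"
  shows "x * ln (y / x) \<le> y - x"
proof (cases "x = 0")
  case False
  then have "0 < x"
    using assms(1) by simp
  then have "x * ln (y / x) \<le> x * (y / x - 1)"
    using assms(2) by (intro mult_left_mono ln_le_minus_one) simp_all
  then show ?thesis
    using \<open>0 < x\<close> by (simp add: algebra_simps)
qed (use assms in simp)

lemma gibbs_inequality:
  assumes "finite A" and w: "\<And>a. a \<in> A \<Longrightarrow> 0 \<le> w a" and r: "\<And>a. a \<in> A \<Longrightarrow> 0 < r a"
  shows "entropy w A \<le> (\<Sum>a\<in>A. w a * ln (sum r A / r a))"
proof (cases "sum w A = 0")
  case True
  then have "w a = 0" if "a \<in> A" for a
    using that assms sum_nonneg_eq_0_iff[of A w] by blast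
  then show ?thesis
    by (simp add: entropy_def)
next
  case False
  define W where "W = sum w A"
  define R where "R = sum r A"
  have W: "0 < W"
    using False w by (simp add: W_def order_less_le sum_nonneg)
  have R: "0 < R"
    unfolding R_def using False assms by (intro sum_pos) auto
  have pointwise: "w a * ln (W / w a) \<le> w a * ln (R / r a) + (r a * W / R - w a)"
    if a: "a \<in> A" for a
  proof (cases "w a = 0")
    case True
    then show ?thesis
      using W R r[OF a] by simp
  next
    case False
    then have "0 < w a"
      using w[OF a] by simp
    then have "ln (W / w a) = ln (R / r a) + ln (r a * W / R / w a)"
      using W R r[OF a] by (simp add: ln_div ln_mult)
    then show ?thesis
      using mult_ln_divide_le_diff[of "w a" "r a * W / R"] w[OF a] r[OF a] W R
      by (simp add: distrib_left)
  qed
  have "entropy w A \<le> (\<Sum>a\<in>A. w a * ln (R / r a) + (r a * W / R - w a))"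
    unfolding entropy_def W_def[symmetric] using pointwise by (rule sum_mono)
  also have "\<dots> = (\<Sum>a\<in>A. w a * ln (R / r a)) + (R * W / R - W)"
    by (simp add: W_def R_def sum.distrib sum_subtractf sum_distrib_right sum_divide_distrib)
  finally show ?thesis
    using R by (simp add: R_def)
qed

lemma entropy_le_ln_card:
  assumes "finite A" "\<And>a. a \<in> A \<Longrightarrow> 0 \<le> w a"
  shows "entropy w A \<le> sum w A * ln (card A)"
  using gibbs_inequality[of A w "\<lambda>_. 1"] assms by (simp add: sum_distrib_right)

definition pushforward :: "('a \<Rightarrow> 'b) \<Rightarrow> 'a set \<Rightarrow> ('a \<Rightarrow> real) \<Rightarrow> 'b \<Rightarrow> real" where
  "pushforward g A w v = sum w {a\<in>A. g a = v}"

lemma entropy_chain_rule: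
  assumes "finite A" and w: "\<And>a. a \<in> A \<Longrightarrow> 0 \<le> w a"
  shows "entropy w A =
    (\<Sum>v\<in>g ` A. entropy w {a\<in>A. g a = v}) + entropy (pushforward g A w) (g ` A)"
proof -
  let ?W = "pushforward g A w"
  have split: "w a * ln (sum w A / w a) = w a * ln (?W (g a) / w a) + w a * ln (sum w A / ?W (g a))"
    if a: "a \<in> A" for a
  proof (cases "w a = 0")
    case False
    then have "0 < w a"
      using w[OF a] by simp
    moreover have "w a \<le> ?W (g a)" "w a \<le> sum w A"
      using assms a by (auto simp: pushforward_def intro!: member_le_sum)
    ultimately show ?thesis
      by (simp add: ln_div algebra_simps)
  qed simp
  have "entropy w A = (\<Sum>v\<in>g ` A. \<Sum>a | a \<in> A \<and> g a = v. w a * ln (sum w A / w a))"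
    unfolding entropy_def by (rule sum.image_gen[OF \<open>finite A\<close>])
  also have "\<dots> = (\<Sum>v\<in>g ` A. entropy w {a\<in>A. g a = v} + ?W v * ln (sum w A / ?W v))"
    by (intro sum.cong refl)
      (simp add: split entropy_def pushforward_def sum.distrib sum_distrib_right)
  also have "\<dots> = (\<Sum>v\<in>g ` A. entropy w {a\<in>A. g a = v}) + entropy ?W (g ` A)"
    by (simp add: entropy_def pushforward_def sum.distrib flip: sum.image_gen[OF \<open>finite A\<close>])
  finally show ?thesis .
qed

text \<open>The entropy of the first component of the joint weight \<open>p\<close> on \<open>A \<times> S\<close>, given the second.\<close>

definition cond_entropy :: "('a \<Rightarrow> 's \<Rightarrow> real) \<Rightarrow> 'a set \<Rightarrow> 's set \<Rightarrow> real" where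
  "cond_entropy p A S = (\<Sum>s\<in>S. entropy (\<lambda>a. p a s) A)"

lemma cond_entropy_chain_rule:
  assumes "finite A" and "\<And>a s. a \<in> A \<Longrightarrow> s \<in> S \<Longrightarrow> 0 \<le> p a s"
  shows "cond_entropy p A S = (\<Sum>v\<in>g ` A. cond_entropy p {a\<in>A. g a = v} S) +
    cond_entropy (\<lambda>v s. pushforward g A (\<lambda>a. p a s) v) (g ` A) S"
proof -
  have "cond_entropy p A S = (\<Sum>s\<in>S. (\<Sum>v\<in>g ` A. entropy (\<lambda>a. p a s) {a\<in>A. g a = v}) +
      entropy (pushforward g A (\<lambda>a. p a s)) (g ` A))"
    unfolding cond_entropy_def using assms by (intro sum.cong refl entropy_chain_rule)
  then show ?thesis
    by (simp add: cond_entropy_def sum.distrib sum.swap[of _ S])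
qed

lemma entropy_le_cond_entropy_add:
  assumes "finite A" "finite S" and nonneg: "\<And>a s. a \<in> A \<Longrightarrow> s \<in> S \<Longrightarrow> 0 \<le> p a s"
  shows "entropy (\<lambda>a. sum (p a) S) A \<le> cond_entropy p A S + entropy (\<lambda>s. \<Sum>a\<in>A. p a s) S"
proof -
  define W where "W = (\<Sum>a\<in>A. sum (p a) S)"
  define P where "P s = (\<Sum>a\<in>A. p a s)" for s
  have W_eq: "W = sum P S"
    unfolding W_def P_def by (rule sum.swap)
  have pointwise: "p a s * ln (W / sum (p a) S) \<le> p a s * ln (P s / p a s) + p a s * ln (W / P s)"
    if a: "a \<in> A" and s: "s \<in> S" for a s
  proof (cases "p a s = 0")
    case False
    then have pos: "0 < p a s"
      using nonneg[OF a s] by simp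
    have row: "p a s \<le> sum (p a) S" and column: "p a s \<le> P s"
      unfolding P_def using assms a s by (auto intro!: member_le_sum)
    have "P s \<le> W"
      unfolding W_eq using assms s by (intro member_le_sum) (auto simp: P_def intro: sum_nonneg)
    then have "ln (W / sum (p a) S) \<le> ln (P s / p a s) + ln (W / P s)"
      using pos row column by (simp add: ln_div)
    then show ?thesis
      using pos by (simp flip: distrib_left)
  qed simp
  have "entropy (\<lambda>a. sum (p a) S) A = (\<Sum>a\<in>A. \<Sum>s\<in>S. p a s * ln (W / sum (p a) S))"
    by (simp add: entropy_def W_def sum_distrib_right)
  also have "\<dots> \<le> (\<Sum>a\<in>A. \<Sum>s\<in>S. p a s * ln (P s / p a s) + p a s * ln (W / P s))"
    using pointwise by (intro sum_mono)
  also have "\<dots> = cond_entropy p A S + entropy P S"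
    unfolding sum.swap[of _ S A]
    by (simp add: cond_entropy_def entropy_def P_def W_eq sum.distrib sum_distrib_right)
  finally show ?thesis
    by (simp add: P_def[abs_def])
qed

section \<open>Las Vegas tests\<close>

definition ambiguous :: "('a \<Rightarrow> 's \<Rightarrow> real) \<Rightarrow> 'a set \<Rightarrow> 's set \<Rightarrow> ('a \<Rightarrow> 'b) \<Rightarrow> 's set" where
  "ambiguous p A S g = {s\<in>S. \<exists>a\<in>A. \<exists>b\<in>A. g a \<noteq> g b \<and> p a s \<noteq> 0 \<and> p b s \<noteq> 0}"

definition las_vegas_test ::
    "real \<Rightarrow> ('a \<Rightarrow> 's \<Rightarrow> real) \<Rightarrow> 'a set \<Rightarrow> 's set \<Rightarrow> ('a \<Rightarrow> 'b) \<Rightarrow> bool" where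
  "las_vegas_test \<epsilon> p A S g \<longleftrightarrow> (\<forall>a\<in>A. sum (p a) (ambiguous p A S g) \<le> \<epsilon> * sum (p a) S)"

lemma las_vegas_test_subset:
  assumes "las_vegas_test \<epsilon> p A S g" "B \<subseteq> A" "finite S"
    and nonneg: "\<And>a s. a \<in> A \<Longrightarrow> s \<in> S \<Longrightarrow> 0 \<le> p a s"
  shows "las_vegas_test \<epsilon> p B S g"
  unfolding las_vegas_test_def
proof
  fix a assume a: "a \<in> B"
  have "sum (p a) (ambiguous p B S g) \<le> sum (p a) (ambiguous p A S g)"
    using assms a by (intro sum_mono2) (auto simp: ambiguous_def)
  also have "\<dots> \<le> \<epsilon> * sum (p a) S"
    using assms(1,2) a by (auto simp: las_vegas_test_def)
  finally show "sum (p a) (ambiguous p B S g) \<le> \<epsilon> * sum (p a) S" .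
qed

text \<open>\<open>h v s\<close> is the probability of announcing the answer \<open>v\<close> in state \<open>s\<close>.\<close>

lemma las_vegas_testI:
  fixes p :: "'a \<Rightarrow> 's \<Rightarrow> real" and g :: "'a \<Rightarrow> 'b"
  assumes "finite S" and p: "\<And>a s. a \<in> A \<Longrightarrow> s \<in> S \<Longrightarrow> 0 \<le> p a s"
    and h: "\<And>v s. s \<in> S \<Longrightarrow> 0 \<le> h v s \<and> h v s \<le> 1"
    and right: "\<And>a. a \<in> A \<Longrightarrow> (1 - \<epsilon>) * sum (p a) S \<le> (\<Sum>s\<in>S. p a s * h (g a) s)"
    and wrong: "\<And>a v. a \<in> A \<Longrightarrow> v \<noteq> g a \<Longrightarrow> (\<Sum>s\<in>S. p a s * h v s) = 0"
  shows "las_vegas_test \<epsilon> p A S g"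
  unfolding las_vegas_test_def
proof
  fix a assume a: "a \<in> A"
  define U where "U = ambiguous p A S g"
  have U: "U \<subseteq> S"
    by (auto simp: U_def ambiguous_def)
  have excluded: "h v s = 0" if "b \<in> A" "s \<in> S" "p b s \<noteq> 0" "v \<noteq> g b" for b s v
    using wrong[OF \<open>b \<in> A\<close> \<open>v \<noteq> g b\<close>] that \<open>finite S\<close> p h
    by (subst (asm) sum_nonneg_eq_0_iff) auto
  have silent: "h v s = 0" if s: "s \<in> U" for v s
  proof -
    obtain b c where "b \<in> A" "c \<in> A" "g b \<noteq> g c" "p b s \<noteq> 0" "p c s \<noteq> 0" "s \<in> S"
      using s by (auto simp: U_def ambiguous_def)
    then show ?thesis
      using excluded[of b s v] excluded[of c s v] by (cases "v = g b") auto
  qed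
  have "(1 - \<epsilon>) * sum (p a) S \<le> (\<Sum>s\<in>S - U. p a s * h (g a) s)"
    using right[OF a] silent \<open>finite S\<close> by (subst sum.mono_neutral_left[of S]) auto
  also have "\<dots> \<le> sum (p a) (S - U)"
    using p[OF a] h by (intro sum_mono mult_left_le) auto
  also have "\<dots> = sum (p a) S - sum (p a) U"
    using \<open>finite S\<close> U by (simp add: sum_diff)
  finally show "sum (p a) (ambiguous p A S g) \<le> \<epsilon> * sum (p a) S"
    by (simp add: U_def left_diff_distrib)
qed

lemma las_vegas_test_pushforward:
  assumes "las_vegas_test \<epsilon> p A S g"
  shows "(\<Sum>s\<in>ambiguous p A S g. pushforward g A (\<lambda>a. p a s) v)
    \<le> \<epsilon> * pushforward g A (\<lambda>a. sum (p a) S) v"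
proof -
  have "(\<Sum>s\<in>ambiguous p A S g. pushforward g A (\<lambda>a. p a s) v) =
      (\<Sum>a | a \<in> A \<and> g a = v. sum (p a) (ambiguous p A S g))"
    unfolding pushforward_def by (rule sum.swap)
  also have "\<dots> \<le> (\<Sum>a | a \<in> A \<and> g a = v. \<epsilon> * sum (p a) S)"
    using assms by (intro sum_mono) (auto simp: las_vegas_test_def)
  finally show ?thesis
    by (simp only: pushforward_def sum_distrib_left)
qed

lemma entropy_pushforward_unambiguous:
  assumes "finite A" and s: "s \<in> S - ambiguous p A S g"
  shows "entropy (pushforward g A (\<lambda>a. p a s)) (g ` A) = 0"
proof (rule entropy_concentrated)
  fix v v'
  assume "pushforward g A (\<lambda>a. p a s) v \<noteq> 0" "pushforward g A (\<lambda>a. p a s) v' \<noteq> 0"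
  then obtain a a' where "a \<in> A" "g a = v" "p a s \<noteq> 0" "a' \<in> A" "g a' = v'" "p a' s \<noteq> 0"
    unfolding pushforward_def by (elim sum.not_neutral_contains_not_neutral) auto
  then show "v = v'"
    using s unfolding ambiguous_def by blast
qed (use \<open>finite A\<close> in simp)

lemma cond_entropy_pushforward_le:
  fixes p :: "'a \<Rightarrow> 's \<Rightarrow> real" and g :: "'a \<Rightarrow> 'b"
  assumes "finite A" "finite S" and nonneg: "\<And>a s. a \<in> A \<Longrightarrow> s \<in> S \<Longrightarrow> 0 \<le> p a s"
    and pos: "\<And>a. a \<in> A \<Longrightarrow> 0 < sum (p a) S"
    and test: "las_vegas_test \<epsilon> p A S g"
  shows "cond_entropy (\<lambda>v s. pushforward g A (\<lambda>a. p a s) v) (g ` A) S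
    \<le> \<epsilon> * entropy (pushforward g A (\<lambda>a. sum (p a) S)) (g ` A)"
proof -
  let ?q = "\<lambda>v s. pushforward g A (\<lambda>a. p a s) v"
  let ?R = "pushforward g A (\<lambda>a. sum (p a) S)"
  let ?U = "ambiguous p A S g"
  have U: "?U \<subseteq> S"
    by (auto simp: ambiguous_def)
  have R_pos: "0 < ?R v" if "v \<in> g ` A" for v
    unfolding pushforward_def by (rule sum_pos) (use that \<open>finite A\<close> pos in auto)
  have R_le: "?R v \<le> sum ?R (g ` A)" if "v \<in> g ` A" for v
    using that \<open>finite A\<close> R_pos by (intro member_le_sum) (auto simp: order_less_imp_le)
  have "cond_entropy ?q (g ` A) S = (\<Sum>s\<in>?U. entropy (\<lambda>v. ?q v s) (g ` A))"
    unfolding cond_entropy_def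
    using \<open>finite S\<close> U entropy_pushforward_unambiguous[OF \<open>finite A\<close>, of _ S p g]
    by (intro sum.mono_neutral_right) auto
  also have "\<dots> \<le> (\<Sum>s\<in>?U. \<Sum>v\<in>g ` A. ?q v s * ln (sum ?R (g ` A) / ?R v))"
    using \<open>finite A\<close> U nonneg R_pos
    by (intro sum_mono gibbs_inequality) (auto simp: pushforward_def intro!: sum_nonneg)
  also have "\<dots> = (\<Sum>v\<in>g ` A. sum (?q v) ?U * ln (sum ?R (g ` A) / ?R v))"
    by (simp add: sum.swap[of _ ?U] sum_distrib_right)
  also have "\<dots> \<le> (\<Sum>v\<in>g ` A. \<epsilon> * ?R v * ln (sum ?R (g ` A) / ?R v))"
    using las_vegas_test_pushforward[OF test] R_pos R_le
    by (intro sum_mono mult_right_mono ln_ge_zero) auto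
  also have "\<dots> = \<epsilon> * entropy ?R (g ` A)"
    by (simp add: entropy_def sum_distrib_left mult.assoc)
  finally show ?thesis .
qed

lemma cond_entropy_le_of_fibres:
  fixes p :: "'a \<Rightarrow> 's \<Rightarrow> real" and g :: "'a \<Rightarrow> 'b"
  assumes "finite A" "finite S" and nonneg: "\<And>a s. a \<in> A \<Longrightarrow> s \<in> S \<Longrightarrow> 0 \<le> p a s"
    and pos: "\<And>a. a \<in> A \<Longrightarrow> 0 < sum (p a) S"
    and test: "las_vegas_test \<epsilon> p A S g"
    and fibres: "\<And>v. v \<in> g ` A \<Longrightarrow> cond_entropy p {a\<in>A. g a = v} S
      \<le> \<epsilon> * entropy (\<lambda>a. sum (p a) S) {a\<in>A. g a = v}"
  shows "cond_entropy p A S \<le> \<epsilon> * entropy (\<lambda>a. sum (p a) S) A"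
proof -
  have "cond_entropy p A S = (\<Sum>v\<in>g ` A. cond_entropy p {a\<in>A. g a = v} S) +
      cond_entropy (\<lambda>v s. pushforward g A (\<lambda>a. p a s) v) (g ` A) S"
    using \<open>finite A\<close> nonneg by (rule cond_entropy_chain_rule)
  also have "\<dots> \<le> (\<Sum>v\<in>g ` A. \<epsilon> * entropy (\<lambda>a. sum (p a) S) {a\<in>A. g a = v}) +
      \<epsilon> * entropy (pushforward g A (\<lambda>a. sum (p a) S)) (g ` A)"
    using fibres cond_entropy_pushforward_le[OF assms(1,2) nonneg pos test]
    by (intro add_mono sum_mono)
  also have "\<dots> = \<epsilon> * entropy (\<lambda>a. sum (p a) S) A"
    using \<open>finite A\<close> pos by (subst entropy_chain_rule[of A _ g])
      (simp_all add: order_less_imp_le sum_distrib_left distrib_left)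
  finally show ?thesis .
qed

lemma cond_entropy_le_of_las_vegas_tests:
  fixes p :: "'a \<Rightarrow> 's \<Rightarrow> real"
  assumes "finite A" "finite S"
    and "\<And>a s. a \<in> A \<Longrightarrow> s \<in> S \<Longrightarrow> 0 \<le> p a s" and "\<And>a. a \<in> A \<Longrightarrow> 0 < sum (p a) S"
    and "\<And>a b. a \<in> A \<Longrightarrow> b \<in> A \<Longrightarrow> a \<noteq> b \<Longrightarrow>
      \<exists>g :: 'a \<Rightarrow> 'b. g a \<noteq> g b \<and> las_vegas_test \<epsilon> p A S g"
  shows "cond_entropy p A S \<le> \<epsilon> * entropy (\<lambda>a. sum (p a) S) A"
  using assms(1,3-)
proof (induction A rule: finite_psubset_induct)
  case (psubset A)
  note nonneg = psubset.prems(1) and pos = psubset.prems(2) and tests = psubset.prems(3)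
  show ?case
  proof (cases "\<exists>a\<in>A. \<exists>b\<in>A. a \<noteq> b")
    case False
    then have "entropy w A = 0" for w :: "'a \<Rightarrow> real"
      using psubset.hyps by (intro entropy_concentrated) auto
    then show ?thesis
      by (simp add: cond_entropy_def)
  next
    case True
    then obtain a b and g :: "'a \<Rightarrow> 'b"
      where ab: "a \<in> A" "b \<in> A" "g a \<noteq> g b" and test: "las_vegas_test \<epsilon> p A S g"
      using tests by metis
    show ?thesis
    proof (rule cond_entropy_le_of_fibres[OF psubset.hyps \<open>finite S\<close> nonneg pos test])
      fix v
      let ?fibre = "{c\<in>A. g c = v}"
      have "las_vegas_test \<epsilon> p ?fibre S h"
        if "las_vegas_test \<epsilon> p A S h" for h :: "'a \<Rightarrow> 'b"
        by (rule las_vegas_test_subset[OF that]) (use \<open>finite S\<close> nonneg in auto)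
      then have "\<exists>h :: 'a \<Rightarrow> 'b. h c \<noteq> h d \<and> las_vegas_test \<epsilon> p ?fibre S h"
        if "c \<in> A" "d \<in> A" "c \<noteq> d" for c d
        using tests[OF that] by blast
      moreover have "a \<notin> ?fibre \<or> b \<notin> ?fibre"
        using ab by auto
      then have "?fibre \<subset> A"
        using ab by blast
      ultimately show "cond_entropy p ?fibre S \<le> \<epsilon> * entropy (\<lambda>c. sum (p c) S) ?fibre"
        using nonneg pos by (intro psubset.IH) auto
    qed
  qed
qed

lemma card_powr_le_of_las_vegas_tests:
  fixes p :: "'a \<Rightarrow> 's \<Rightarrow> real"
  assumes "finite A" "finite S"
    and nonneg: "\<And>a s. a \<in> A \<Longrightarrow> s \<in> S \<Longrightarrow> 0 \<le> p a s"
    and normalised: "\<And>a. a \<in> A \<Longrightarrow> sum (p a) S = 1"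
    and tests: "\<And>a b. a \<in> A \<Longrightarrow> b \<in> A \<Longrightarrow> a \<noteq> b \<Longrightarrow>
      \<exists>g :: 'a \<Rightarrow> 'b. g a \<noteq> g b \<and> las_vegas_test \<epsilon> p A S g"
  shows "real (card A) powr (1 - \<epsilon>) \<le> card S"
proof (cases "A = {}")
  case False
  then have A: "0 < card A"
    using \<open>finite A\<close> by (simp add: card_gt_0_iff)
  have pos: "0 < sum (p a) S" if "a \<in> A" for a
    by (simp add: normalised[OF that])
  have S: "0 < card S"
    using False pos \<open>finite S\<close> by (force simp: card_gt_0_iff)
  let ?H = "entropy (\<lambda>a. sum (p a) S) A"
  have "?H \<le> cond_entropy p A S + entropy (\<lambda>s. \<Sum>a\<in>A. p a s) S"
    by (rule entropy_le_cond_entropy_add) (fact assms)+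
  moreover have "cond_entropy p A S \<le> \<epsilon> * ?H"
    by (rule cond_entropy_le_of_las_vegas_tests) (fact assms pos)+
  moreover have "entropy (\<lambda>s. \<Sum>a\<in>A. p a s) S \<le> (\<Sum>s\<in>S. \<Sum>a\<in>A. p a s) * ln (card S)"
    using \<open>finite S\<close> nonneg by (intro entropy_le_ln_card sum_nonneg)
  ultimately have "(1 - \<epsilon>) * ?H \<le> (\<Sum>a\<in>A. sum (p a) S) * ln (card S)"
    by (simp add: sum.swap[of _ A] left_diff_distrib)
  then have "card A * ((1 - \<epsilon>) * ln (card A)) \<le> card A * ln (card S)"
    by (simp add: entropy_def normalised mult.left_commute)
  then have "(1 - \<epsilon>) * ln (card A) \<le> ln (card S)"
    using A by simp
  then show ?thesis
    using A S by (simp add: powr_def ln_ge_iff)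
qed simp

section \<open>The width of Las Vegas programs\<close>

lemma las_vegas_test_state_prob:
  assumes lv: "is_lv_pobdd n m P" and comp: "lv_computes n \<epsilon> P f" and j: "j \<le> n"
    and X: "X \<subseteq> bool_cube n" and y: "y \<in> bool_cube n"
  shows "las_vegas_test \<epsilon> (state_prob P j) X {..<m}
    (\<lambda>x. y \<in> subfunction n f (pobdd_order P) j x)"
proof -
  let ?g = "\<lambda>x. y \<in> subfunction n f (pobdd_order P) j x"
  let ?z = "\<lambda>x. override_on y x (pobdd_order P ` {1..j})"
  have P: "is_pobdd n m P"
    using lv by (simp add: is_lv_pobdd_def)
  have "\<forall>b. \<exists>h. (\<forall>s<m. 0 \<le> h s \<and> h s \<le> 1) \<and> (\<forall>x. pobdd_prob n P (?z x) (lv_answer P b) =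
      (\<Sum>s<m. state_prob P j x s * h s))"
    using pobdd_prob_override_on[OF P lv_answer_subset[OF lv] j] by (rule allI)
  from choice[OF this] obtain h where h: "\<forall>b. (\<forall>s<m. 0 \<le> h b s \<and> h b s \<le> 1) \<and>
      (\<forall>x. pobdd_prob n P (?z x) (lv_answer P b) =
        (\<Sum>s<m. state_prob P j x s * h b s))"
    by (rule exE)
  then have prob: "pobdd_prob n P (?z x) (lv_answer P b) =
      (\<Sum>s<m. state_prob P j x s * h b s)" for b x
    by simp
  have z: "?z x \<in> bool_cube n" "f (?z x) \<longleftrightarrow> ?g x" if "x \<in> X" for x
    using X y that by (auto simp: subfunction_def intro: override_on_in_bool_cube)
  have right: "1 - \<epsilon> \<le> (\<Sum>s<m. state_prob P j x s * h (?g x) s)"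
    and wrong: "(\<Sum>s<m. state_prob P j x s * h (\<not> ?g x) s) = 0" if "x \<in> X" for x
    using lv_computes_prob[OF comp z(1)[OF that]] unfolding z(2)[OF that] prob .
  show ?thesis
  proof (rule las_vegas_testI[where h = h])
    show "0 \<le> state_prob P j x s" if "s \<in> {..<m}" for x s
      using state_prob_nonneg[OF P j] that by simp
    show "(1 - \<epsilon>) * (\<Sum>s<m. state_prob P j x s)
        \<le> (\<Sum>s<m. state_prob P j x s * h (?g x) s)" if "x \<in> X" for x
      using right[OF that] by (simp add: sum_state_prob[OF P j])
    show "(\<Sum>s<m. state_prob P j x s * h b s) = 0" if "x \<in> X" "b \<noteq> ?g x" for x b
    proof -
      have "b = (\<not> ?g x)"
        using \<open>b \<noteq> ?g x\<close> by blast
      then show ?thesis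
        using wrong[OF \<open>x \<in> X\<close>] by simp
    qed
  qed (use h in simp_all)
qed

lemma card_subfunctions_powr_le:
  assumes lv: "is_lv_pobdd n m P" and comp: "lv_computes n \<epsilon> P f" and j: "j \<le> n"
  shows "real (card (subfunctions n f (pobdd_order P) j)) powr (1 - \<epsilon>) \<le> m"
proof -
  let ?sub = "subfunction n f (pobdd_order P) j"
  have "\<exists>X\<subseteq>bool_cube n. inj_on ?sub X \<and> subfunctions n f (pobdd_order P) j = ?sub ` X"
    unfolding subfunctions_def by (rule subset_image_inj[THEN iffD1]) simp
  then obtain X where X: "X \<subseteq> bool_cube n" "inj_on ?sub X"
    and image: "subfunctions n f (pobdd_order P) j = ?sub ` X"
    by (elim exE conjE)
  have P: "is_pobdd n m P"
    using lv by (simp add: is_lv_pobdd_def)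
  have "real (card X) powr (1 - \<epsilon>) \<le> card {..<m}"
  proof (rule card_powr_le_of_las_vegas_tests[where p = "state_prob P j"])
    show "finite X"
      using X(1) finite_bool_cube finite_subset by blast
    show "\<exists>g :: (nat \<Rightarrow> bool) \<Rightarrow> bool. g a \<noteq> g b \<and>
        las_vegas_test \<epsilon> (state_prob P j) X {..<m} g"
      if "a \<in> X" "b \<in> X" "a \<noteq> b" for a b
    proof -
      have "?sub a \<noteq> ?sub b"
        using X(2) that by (auto dest: inj_onD)
      then obtain y where "y \<in> bool_cube n" "(y \<in> ?sub a) \<noteq> (y \<in> ?sub b)"
        by (auto simp: subfunction_def)
      then show ?thesis
        by (intro exI[of _ "\<lambda>x. y \<in> ?sub x"] conjI las_vegas_test_state_prob[OF lv comp j X(1)])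
    qed
  qed (use state_prob_nonneg[OF P j] sum_state_prob[OF P j] in simp_all)
  then show ?thesis
    by (simp add: image card_image[OF X(2)])
qed

theorem theorem1:
  fixes n :: nat and f :: "(nat \<Rightarrow> bool) \<Rightarrow> bool" and \<epsilon> :: real
  assumes "0 \<le> \<epsilon>" and "\<epsilon> < 1"
  shows "real (OBDD n f) powr (1 - \<epsilon>) \<le> real (LV_OBDD n \<epsilon> f)"
proof -
  obtain P where P: "is_lv_pobdd n (LV_OBDD n \<epsilon> f) P" "lv_computes n \<epsilon> P f"
    using LV_OBDD_attained[OF assms(1)] .
  then have "pobdd_order P permutes {1..n}"
    by (simp add: is_lv_pobdd_def is_pobdd_def)
  then obtain j where j: "j \<le> n" "OBDD n f \<le> card (subfunctions n f (pobdd_order P) j)"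
    by (rule OBDD_le_card_subfunctions)
  then have "real (OBDD n f) powr (1 - \<epsilon>) \<le>
      real (card (subfunctions n f (pobdd_order P) j)) powr (1 - \<epsilon>)"
    using assms(2) by (intro powr_mono2) auto
  also have "\<dots> \<le> LV_OBDD n \<epsilon> f"
    using P j(1) by (rule card_subfunctions_powr_le)
  finally show ?thesis .
qed

end
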